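(* For any $1\leq p<\infty$ there exists a $2^{1/p}$-dispersed set $P\subseteq\ell_p$ such that $R(P)=1$.
   Context: $\ell_p$ is the space of real sequences $x=(x_i)_{i\in\mathbb{N}}$ with $\sum_{i=1}^\infty |x_i|^p<\infty$, with norm $\|x\|_p=\left(\sum_{i=1}^\infty |x_i|^p\right)^{1/p}$. $B(x,r)$ denotes the closed ball with center $x$ and radius $r$. A subset $P$ of a normed space $X$ is $\alpha$-dispersed if $\|x-y\|>\alpha$ (strict inequality) for all distinct $x,y\in P$. A subset $P\subseteq X$ is an $R$-covering if $X=\bigcup_{x\in P}B(x,R)$. For $P\subseteq X$ define $R(P):=\inf\{R : P \text{ is an } R\text{-covering}\}$ (with the infimum of the empty set equal to $+\infty$). *)

theory Defs
  imports "HOL-Analysis.Analysis"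
begin

text \<open>The exponent \<open>p\<close> is a term-level parameter, so \<open>\<ell>\<^sub>p\<close> is a carrier set inside
  \<open>nat \<Rightarrow> real\<close> (with coordinates indexed from 0) and not a type.\<close>

definition lp_space :: "real \<Rightarrow> (nat \<Rightarrow> real) set" where
  "lp_space p = {x. summable (\<lambda>i. \<bar>x i\<bar> powr p)}"

definition lp_norm :: "real \<Rightarrow> (nat \<Rightarrow> real) \<Rightarrow> real" where
  "lp_norm p x = (\<Sum>i. \<bar>x i\<bar> powr p) powr (1 / p)"

definition lp_dist :: "real \<Rightarrow> (nat \<Rightarrow> real) \<Rightarrow> (nat \<Rightarrow> real) \<Rightarrow> real" where
  "lp_dist p x y = lp_norm p (\<lambda>i. x i - y i)"

text \<open>The following notions depend on a normed space only through its carrier \<open>X\<close> and the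
  distance \<open>d\<close> induced by its norm.  The library's \<open>Metric_space.mcball X d x R\<close> is the closed
  ball \<open>{y \<in> X. d x y \<le> R}\<close> for \<open>x \<in> X\<close>; outside the locale it takes \<open>X\<close> and \<open>d\<close> as arguments.\<close>

definition dispersed :: "'a set \<Rightarrow> ('a \<Rightarrow> 'a \<Rightarrow> real) \<Rightarrow> real \<Rightarrow> 'a set \<Rightarrow> bool" where
  "dispersed X d \<alpha> P \<longleftrightarrow> P \<subseteq> X \<and> (\<forall>x\<in>P. \<forall>y\<in>P. x \<noteq> y \<longrightarrow> d x y > \<alpha>)"

definition is_covering :: "'a set \<Rightarrow> ('a \<Rightarrow> 'a \<Rightarrow> real) \<Rightarrow> real \<Rightarrow> 'a set \<Rightarrow> bool" where
  "is_covering X d R P \<longleftrightarrow> P \<subseteq> X \<and> X = (\<Union>x\<in>P. Metric_space.mcball X d x R)"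

text \<open>The infimum is taken in the extended reals, so that it is \<open>\<infinity>\<close> if there is no covering radius.\<close>

definition covering_radius :: "'a set \<Rightarrow> ('a \<Rightarrow> 'a \<Rightarrow> real) \<Rightarrow> 'a set \<Rightarrow> ereal" where
  "covering_radius X d P = Inf {ereal R | R. is_covering X d R P}"

text \<open>For \<open>p \<ge> 1\<close> the space \<open>\<ell>\<^sub>p\<close> is indeed a metric space (Minkowski's inequality).\<close>

lemma powr_convex_nonneg:
  fixes u v s t p :: real
  assumes "p \<ge> 1" "u \<ge> 0" "v \<ge> 0" "s \<ge> 0" "t \<ge> 0" "s + t = 1"
  shows "(s * u + t * v) powr p \<le> s * u powr p + t * v powr p"
proof -
  have scale: "(r * w) powr p \<le> r * w powr p" if "0 \<le> r" "r \<le> 1" "0 \<le> w" for r w :: real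
  proof -
    have "r powr p \<le> r"
      using powr_mono'[of 1 p r] that assms(1) by simp
    then show ?thesis
      using that by (simp add: powr_mult mult_right_mono)
  qed
  consider "u = 0" | "v = 0" | "u > 0" "v > 0"
    using assms by linarith
  then show ?thesis
  proof cases
    case 1
    then show ?thesis using scale[of t v] assms by simp
  next
    case 2
    then show ?thesis using scale[of s u] assms by simp
  next
    case 3
    then have "((1 - t) *\<^sub>R u + t *\<^sub>R v) powr p \<le> (1 - t) * u powr p + t * v powr p"
      using convex_onD[OF powr_convex[OF assms(1)], of t u v] assms by simp
    moreover have "1 - t = s" using assms by simp
    ultimately show ?thesis by simp
  qed
qed

lemma lp_sum_le_powr:
  assumes p: "p \<ge> 1" and A: "lp_norm p x \<le> A" "A > 0"
  shows "(\<Sum>i. \<bar>x i\<bar> powr p) \<le> A powr p"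
proof (cases "(\<Sum>i. \<bar>x i\<bar> powr p) > 0")
  case True
  then have "(lp_norm p x) powr p = (\<Sum>i. \<bar>x i\<bar> powr p)"
    using p by (simp add: lp_norm_def powr_powr)
  moreover have "(lp_norm p x) powr p \<le> A powr p"
    using A p by (intro powr_mono2) (auto simp: lp_norm_def)
  ultimately show ?thesis by simp
next
  case False
  then show ?thesis using powr_ge_zero[of A p] by linarith
qed

lemma lp_add_aux:
  assumes p: "p \<ge> 1" and x: "x \<in> lp_space p" and y: "y \<in> lp_space p"
    and A: "lp_norm p x \<le> A" "A > 0" and B: "lp_norm p y \<le> B" "B > 0"
  shows "(\<lambda>i. x i + y i) \<in> lp_space p" and "lp_norm p (\<lambda>i. x i + y i) \<le> A + B"
proof -
  define c where "c = (A + B) powr p"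
  define g where "g i = c * (A / (A + B) / A powr p * \<bar>x i\<bar> powr p
      + B / (A + B) / B powr p * \<bar>y i\<bar> powr p)" for i
  have sx: "summable (\<lambda>i. \<bar>x i\<bar> powr p)" and sy: "summable (\<lambda>i. \<bar>y i\<bar> powr p)"
    using x y by (auto simp: lp_space_def)
  have sg: "summable g"
    unfolding g_def by (intro summable_mult summable_add sx sy)
  have le: "\<bar>x i + y i\<bar> powr p \<le> g i" for i
  proof -
    let ?z = "A / (A + B) * (\<bar>x i\<bar> / A) + B / (A + B) * (\<bar>y i\<bar> / B)"
    have eq: "\<bar>x i\<bar> + \<bar>y i\<bar> = (A + B) * ?z"
    proof -
      have "A / (A + B) * (\<bar>x i\<bar> / A) = \<bar>x i\<bar> / (A + B)"
        and "B / (A + B) * (\<bar>y i\<bar> / B) = \<bar>y i\<bar> / (A + B)"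
        using A B by auto
      then show ?thesis
        using A B by (simp add: add_divide_distrib[symmetric])
    qed
    have "\<bar>x i + y i\<bar> powr p \<le> (\<bar>x i\<bar> + \<bar>y i\<bar>) powr p"
      using p by (intro powr_mono2) auto
    also have "\<dots> = c * ?z powr p"
      unfolding eq c_def using A B by (intro powr_mult)
    also have "\<dots> \<le> c * (A / (A + B) * (\<bar>x i\<bar> / A) powr p + B / (A + B) * (\<bar>y i\<bar> / B) powr p)"
      unfolding c_def using A B
      by (intro mult_left_mono powr_convex_nonneg p) (auto simp: add_divide_distrib[symmetric])
    also have "\<dots> = g i"
      using A B by (simp add: g_def powr_divide)
    finally show ?thesis .
  qed
  have s: "summable (\<lambda>i. \<bar>x i + y i\<bar> powr p)"
    by (rule summable_comparison_test'[OF sg, of 0]) (use le in simp)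
  then show "(\<lambda>i. x i + y i) \<in> lp_space p" by (simp add: lp_space_def)
  have "(\<Sum>i. \<bar>x i + y i\<bar> powr p) \<le> suminf g"
    by (intro suminf_le le s sg)
  also have "\<dots> = c * (A / (A + B) / A powr p * (\<Sum>i. \<bar>x i\<bar> powr p)
      + B / (A + B) / B powr p * (\<Sum>i. \<bar>y i\<bar> powr p))"
    unfolding g_def
    by (simp only: suminf_mult suminf_add[symmetric] summable_mult summable_add sx sy)
  also have "\<dots> \<le> c * (A / (A + B) / A powr p * A powr p + B / (A + B) / B powr p * B powr p)"
    unfolding c_def using A B lp_sum_le_powr[OF p A] lp_sum_le_powr[OF p B]
    by (intro mult_left_mono add_mono) auto
  also have "\<dots> = c"
    using A B by (simp add: add_divide_distrib[symmetric])
  finally have "(\<Sum>i. \<bar>x i + y i\<bar> powr p) powr (1 / p) \<le> c powr (1 / p)"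
    using p s by (intro powr_mono2) (auto intro: suminf_nonneg)
  also have "c powr (1 / p) = A + B"
    using A B p by (simp add: c_def powr_powr)
  finally show "lp_norm p (\<lambda>i. x i + y i) \<le> A + B"
    by (simp add: lp_norm_def)
qed

lemma lp_norm_nonneg: "lp_norm p x \<ge> 0"
  by (simp add: lp_norm_def)

lemma lp_space_add:
  assumes "p \<ge> 1" "x \<in> lp_space p" "y \<in> lp_space p"
  shows "(\<lambda>i. x i + y i) \<in> lp_space p"
  using lp_add_aux(1)[OF assms, of "lp_norm p x + 1" "lp_norm p y + 1"]
    lp_norm_nonneg[of p x] lp_norm_nonneg[of p y] by simp

lemma lp_norm_triangle:
  assumes "p \<ge> 1" "x \<in> lp_space p" "y \<in> lp_space p"
  shows "lp_norm p (\<lambda>i. x i + y i) \<le> lp_norm p x + lp_norm p y"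
proof (rule field_le_epsilon)
  fix e :: real
  assume "e > 0"
  then show "lp_norm p (\<lambda>i. x i + y i) \<le> lp_norm p x + lp_norm p y + e"
    using lp_add_aux(2)[OF assms, of "lp_norm p x + e / 2" "lp_norm p y + e / 2"]
      lp_norm_nonneg[of p x] lp_norm_nonneg[of p y] by simp
qed

lemma lp_space_diff:
  assumes "p \<ge> 1" "x \<in> lp_space p" "y \<in> lp_space p"
  shows "(\<lambda>i. x i - y i) \<in> lp_space p"
  using lp_space_add[of p x "\<lambda>i. - y i"] assms by (simp add: lp_space_def)

lemma lp_norm_eq_0_iff:
  assumes "x \<in> lp_space p"
  shows "lp_norm p x = 0 \<longleftrightarrow> (\<forall>i. x i = 0)"
  using suminf_eq_zero_iff[of "\<lambda>i. \<bar>x i\<bar> powr p"] assms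
  by (auto simp: lp_norm_def lp_space_def)

lemma Metric_space_lp:
  assumes p: "p \<ge> 1"
  shows "Metric_space (lp_space p) (lp_dist p)"
proof
  show "0 \<le> lp_dist p x y" for x y
    by (simp add: lp_dist_def lp_norm_nonneg)
  show "lp_dist p x y = lp_dist p y x" for x y
    by (simp add: lp_dist_def lp_norm_def abs_minus_commute)
  show "lp_dist p x y = 0 \<longleftrightarrow> x = y" if "x \<in> lp_space p" "y \<in> lp_space p" for x y
    using lp_norm_eq_0_iff[OF lp_space_diff[OF p that]] by (auto simp: lp_dist_def)
  show "lp_dist p x z \<le> lp_dist p x y + lp_dist p y z"
    if "x \<in> lp_space p" "y \<in> lp_space p" "z \<in> lp_space p" for x y z
    using lp_norm_triangle[OF p lp_space_diff[OF p that(1,2)] lp_space_diff[OF p that(2,3)]]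
    by (simp add: lp_dist_def)
qed

end

theory Submission
  imports Defs
begin

text \<open>
  The set is built greedily along a countable dense sequence of finitely supported points.
  Suppose that finitely many finitely supported points have been chosen and that the next
  dense point \<open>x\<close> has distance more than \<open>1\<close> from all of them.  Far out there is a coordinate
  \<open>k\<close> at which \<open>x\<close> and all chosen points vanish, and the point \<open>x + e\<^sub>k\<close> is added.  It has
  distance exactly \<open>1\<close> from \<open>x\<close>, and for each earlier point \<open>q\<close> the norm splits over the
  disjoint supports:
  \<open>\<parallel>x + e\<^sub>k - q\<parallel>\<^sup>p = \<parallel>x - q\<parallel>\<^sup>p + 1 > 2\<close>.
  So the union of all stages is \<open>2\<^sup>1\<^sup>/\<^sup>p\<close>-dispersed (\<open>greedy_extension\<close>), and every dense point
  lies within \<open>1\<close> of it (\<open>greedy_set\<close>).  By density (\<open>lp_rational_approx\<close>) it is an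
  \<open>R\<close>-covering for each \<open>R > 1\<close>.  On the other hand no added point has norm less than \<open>1\<close>,
  because its coordinate \<open>k\<close> is \<open>1\<close>; so the origin keeps smaller radii from covering.
\<close>

section \<open>Norms of finitely supported perturbations\<close>

lemma lp_norm_powr:
  assumes "p \<ge> 1" "z \<in> lp_space p"
  shows "lp_norm p z powr p = (\<Sum>i. \<bar>z i\<bar> powr p)"
proof -
  have "(\<Sum>i. \<bar>z i\<bar> powr p) \<ge> 0"
    using assms by (intro suminf_nonneg) (auto simp: lp_space_def)
  then show ?thesis
    using assms by (simp add: lp_norm_def powr_powr)
qed

lemma lp_space_finite_support:
  assumes "finite {i. z i \<noteq> 0}"
  shows "z \<in> lp_space p"
  unfolding lp_space_def
  by (auto intro!: summable_finite[OF assms])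

text \<open>This is where \<open>\<ell>\<^sub>p\<close> enters: \<open>p\<close>-th powers of norms add over disjoint supports, here those
  of \<open>z\<close> and of a multiple of a unit vector.\<close>

lemma lp_norm_upd:
  assumes p: "p \<ge> 1" and z: "z \<in> lp_space p" "z k = 0"
  shows "z(k := c) \<in> lp_space p"
    and "lp_norm p (z(k := c)) powr p = lp_norm p z powr p + \<bar>c\<bar> powr p"
proof -
  have split: "\<bar>(z(k := c)) i\<bar> powr p = \<bar>z i\<bar> powr p + (if i = k then \<bar>c\<bar> powr p else 0)" for i
    using z by simp
  have "(\<lambda>i. \<bar>z i\<bar> powr p) sums (\<Sum>i. \<bar>z i\<bar> powr p)"
    using z by (simp add: lp_space_def summable_sums)
  from sums_add[OF this sums_single[of k "\<lambda>_. \<bar>c\<bar> powr p"]]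
  have s: "(\<lambda>i. \<bar>(z(k := c)) i\<bar> powr p) sums ((\<Sum>i. \<bar>z i\<bar> powr p) + \<bar>c\<bar> powr p)"
    by (simp only: split)
  then show mem: "z(k := c) \<in> lp_space p"
    by (auto simp: lp_space_def sums_iff)
  show "lp_norm p (z(k := c)) powr p = lp_norm p z powr p + \<bar>c\<bar> powr p"
    using s unfolding lp_norm_powr[OF p mem] lp_norm_powr[OF p z(1)] by (simp only: sums_iff)
qed

lemma lp_norm_upd_one_ge:
  assumes "p \<ge> 1" "z \<in> lp_space p" "z k = 0"
  shows "lp_norm p (z(k := 1)) \<ge> 1"
proof (rule ccontr)
  assume "\<not> ?thesis"
  then have "lp_norm p (z(k := 1)) powr p < 1 powr p"
    using assms(1) by (intro powr_less_mono2) (auto simp: lp_norm_nonneg)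
  then show False
    using lp_norm_upd(2)[OF assms, of 1] powr_ge_zero[of "lp_norm p z" p] by simp
qed

lemma lp_norm_upd_one_gt:
  assumes "p \<ge> 1" "z \<in> lp_space p" "z k = 0" and gt: "lp_norm p z > 1"
  shows "lp_norm p (z(k := 1)) > 2 powr (1 / p)"
proof -
  have "1 powr p < lp_norm p z powr p"
    using gt assms(1) by (intro powr_less_mono2) auto
  then have "2 < lp_norm p (z(k := 1)) powr p"
    using lp_norm_upd(2)[OF assms(1-3), of 1] by simp
  then have "2 powr (1 / p) < (lp_norm p (z(k := 1)) powr p) powr (1 / p)"
    using assms(1) by (intro powr_less_mono2) auto
  then show ?thesis
    using assms(1) lp_norm_nonneg[of p "z(k := 1)"] by (simp add: powr_powr)
qed

lemma lp_dist_upd_one: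
  assumes "p \<ge> 1" "x k = 0"
  shows "lp_dist p x (x(k := 1)) = 1"
proof -
  have "(\<lambda>i. \<bar>x i - (x(k := 1)) i\<bar> powr p) = (\<lambda>i. if i = k then 1 else 0)"
    using assms by auto
  then show ?thesis
    using sums_single[of k "\<lambda>_. 1 :: real"] by (simp add: lp_dist_def lp_norm_def sums_iff)
qed

section \<open>The greedy construction\<close>

text \<open>The invariant of the construction.  The bound on the norms keeps the origin at distance at
  least \<open>1\<close> from all chosen points, which later gives \<open>R(P) \<ge> 1\<close>.\<close>

definition admissible :: "real \<Rightarrow> (nat \<Rightarrow> real) set \<Rightarrow> bool" where
  "admissible p S \<longleftrightarrow> finite S \<and> (\<forall>y\<in>S. finite {i. y i \<noteq> 0}) \<and>
     dispersed (lp_space p) (lp_dist p) (2 powr (1 / p)) S \<and> (\<forall>y\<in>S. lp_norm p y \<ge> 1)"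

text \<open>Since only finitely many coordinates are in use, there is room for a new point at
  distance \<open>1\<close> from \<open>x\<close> whenever \<open>x\<close> is not yet covered.\<close>

lemma greedy_extension:
  assumes p: "p \<ge> 1" and S: "admissible p S" and x: "finite {i. x i \<noteq> 0}"
  shows "\<exists>T. admissible p T \<and> S \<subseteq> T \<and> (\<exists>q\<in>T. lp_dist p x q \<le> 1)"
proof (cases "\<exists>q\<in>S. lp_dist p x q \<le> 1")
  case True
  then show ?thesis using S by blast
next
  case False
  interpret Metric_space "lp_space p" "lp_dist p"
    by (rule Metric_space_lp[OF p])
  have "finite (\<Union>y\<in>insert x S. {i. y i \<noteq> 0})"
    using S x by (auto simp: admissible_def)
  then obtain k where "k \<notin> (\<Union>y\<in>insert x S. {i. y i \<noteq> 0})"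
    using ex_new_if_finite infinite_UNIV_nat by blast
  then have xk: "x k = 0" and Sk: "\<And>y. y \<in> S \<Longrightarrow> y k = 0"
    by auto
  have xl: "x \<in> lp_space p"
    by (rule lp_space_finite_support[OF x])
  let ?q = "x(k := 1)"
  have ql: "?q \<in> lp_space p"
    by (rule lp_norm_upd(1)[where z = x]) (use p xl xk in auto)
  have disp: "dispersed (lp_space p) (lp_dist p) (2 powr (1 / p)) S"
    using S by (simp add: admissible_def)
  have far: "lp_dist p ?q y > 2 powr (1 / p)" if y: "y \<in> S" for y
  proof -
    have yl: "y \<in> lp_space p"
      using disp y by (auto simp: dispersed_def)
    have "lp_norm p (\<lambda>i. x i - y i) > 1"
      using False y by (simp add: lp_dist_def not_le)
    then have "lp_norm p ((\<lambda>i. x i - y i)(k := 1)) > 2 powr (1 / p)"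
      using p xk Sk[OF y] by (intro lp_norm_upd_one_gt lp_space_diff xl yl) auto
    also have "(\<lambda>i. x i - y i)(k := 1) = (\<lambda>i. ?q i - y i)"
      using Sk[OF y] by auto
    finally show ?thesis by (simp only: lp_dist_def)
  qed
  have "dispersed (lp_space p) (lp_dist p) (2 powr (1 / p)) (insert ?q S)"
    using disp far ql commute[of ?q] unfolding dispersed_def by (metis insert_iff insert_subset)
  moreover have "finite {i. ?q i \<noteq> 0}"
    by (rule finite_subset[of _ "insert k {i. x i \<noteq> 0}"]) (use x in auto)
  moreover have "lp_norm p ?q \<ge> 1"
    by (rule lp_norm_upd_one_ge[OF p xl xk])
  ultimately have "admissible p (insert ?q S)"
    using S by (simp add: admissible_def)
  moreover have "lp_dist p x ?q \<le> 1"
    using lp_dist_upd_one[of p x k] p xk by simp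
  ultimately show ?thesis
    by blast
qed

lemma dispersed_Union_incseq:
  fixes S :: "nat \<Rightarrow> 'a set"
  assumes "incseq S" "\<And>n. dispersed X d \<alpha> (S n)"
  shows "dispersed X d \<alpha> (\<Union>n. S n)"
  unfolding dispersed_def
proof (intro conjI ballI impI)
  show "(\<Union>n. S n) \<subseteq> X"
    using assms(2) by (auto simp: dispersed_def)
next
  fix x y
  assume "x \<in> (\<Union>n. S n)" "y \<in> (\<Union>n. S n)" "x \<noteq> y"
  then obtain m n where "x \<in> S m" "y \<in> S n"
    by auto
  then have "x \<in> S (max m n)" "y \<in> S (max m n)"
    using incseqD[OF assms(1)] by (meson max.cobounded1 max.cobounded2 subsetD)+
  then show "d x y > \<alpha>"
    using assms(2)[of "max m n"] \<open>x \<noteq> y\<close> by (auto simp: dispersed_def)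
qed

lemma greedy_set:
  fixes x :: "nat \<Rightarrow> nat \<Rightarrow> real"
  assumes p: "p \<ge> 1" and x: "\<And>n. finite {i. x n i \<noteq> 0}"
  shows "\<exists>P. dispersed (lp_space p) (lp_dist p) (2 powr (1 / p)) P \<and>
     (\<forall>q\<in>P. lp_norm p q \<ge> 1) \<and> (\<forall>n. \<exists>q\<in>P. lp_dist p (x n) q \<le> 1)"
proof -
  have "admissible p {}"
    by (simp add: admissible_def dispersed_def)
  then have "\<exists>S. \<forall>n. admissible p (S n) \<and>
      (S n \<subseteq> S (Suc n) \<and> (\<exists>q\<in>S (Suc n). lp_dist p (x n) q \<le> 1))"
    using greedy_extension[OF p _ x] by (intro dependent_nat_choice) blast+
  then obtain S where S: "\<And>n. admissible p (S n)" "\<And>n. S n \<subseteq> S (Suc n)"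
    and cov: "\<And>n. \<exists>q\<in>S (Suc n). lp_dist p (x n) q \<le> 1"
    by blast
  have "dispersed (lp_space p) (lp_dist p) (2 powr (1 / p)) (\<Union>n. S n)"
    using S by (intro dispersed_Union_incseq incseq_SucI) (auto simp: admissible_def)
  moreover have "\<forall>q\<in>\<Union>n. S n. lp_norm p q \<ge> 1"
    using S(1) by (auto simp: admissible_def)
  moreover have "\<forall>n. \<exists>q\<in>\<Union>n. S n. lp_dist p (x n) q \<le> 1"
    using cov by blast
  ultimately show ?thesis
    by blast
qed

section \<open>A countable dense set\<close>

text \<open>Lists of rationals, padded with zeros, are a countable index set for the finitely
  supported rational sequences.\<close>

definition padded :: "rat list \<Rightarrow> nat \<Rightarrow> real" where
  "padded l i = (if i < length l then of_rat (l ! i) else 0)"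

lemma finite_support_padded: "finite {i. padded l i \<noteq> 0}"
  by (rule finite_subset[of _ "{..<length l}"]) (auto simp: padded_def)

text \<open>The \<open>p\<close>-th power of the error is split evenly: half for the tail that is cut off, half
  for the rounding of the finitely many remaining coordinates.\<close>

lemma lp_rational_approx:
  assumes p: "p \<ge> 1" and z: "z \<in> lp_space p" and e: "e > 0"
  shows "\<exists>l. lp_dist p (padded l) z \<le> e"
proof -
  define c where "c = e powr p / 2"
  have c: "c > 0"
    using e by (simp add: c_def)
  have sz: "summable (\<lambda>i. \<bar>z i\<bar> powr p)"
    using z by (simp add: lp_space_def)
  obtain N where tail: "norm (\<Sum>i. \<bar>z (i + N)\<bar> powr p) < c"
    using suminf_exist_split[OF c sz] by blast
  define \<delta> where "\<delta> = (c / real (Suc N)) powr (1 / p)"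
  have \<delta>: "\<delta> > 0" "\<delta> powr p = c / real (Suc N)"
    using c p by (simp_all add: \<delta>_def powr_powr)
  have "\<exists>r. \<bar>of_rat r - z i\<bar> < \<delta>" for i
  proof -
    obtain r where "z i - \<delta> < of_rat r" "of_rat r < z i + \<delta>"
      using of_rat_dense[of "z i - \<delta>" "z i + \<delta>"] \<delta>(1) by auto
    then show ?thesis
      by (intro exI[of _ r]) (simp add: abs_less_iff)
  qed
  then obtain r where r: "\<And>i. \<bar>of_rat (r i) - z i\<bar> < \<delta>"
    by metis
  define l where "l = map r [0..<N]"
  let ?w = "\<lambda>i. padded l i - z i"
  have w: "?w \<in> lp_space p"
    by (intro lp_space_diff p z lp_space_finite_support finite_support_padded)
  have "(\<Sum>i. \<bar>?w i\<bar> powr p) = (\<Sum>i. \<bar>?w (i + N)\<bar> powr p) + (\<Sum>i<N. \<bar>?w i\<bar> powr p)"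
    using w by (intro suminf_split_initial_segment) (simp add: lp_space_def)
  also have "(\<Sum>i. \<bar>?w (i + N)\<bar> powr p) \<le> c"
    using tail by (simp add: padded_def l_def)
  also have "(\<Sum>i<N. \<bar>?w i\<bar> powr p) \<le> (\<Sum>i<N. c / real (Suc N))"
    unfolding \<delta>(2)[symmetric]
    using p r by (intro sum_mono powr_mono2) (auto simp: padded_def l_def intro: less_imp_le)
  also have "\<dots> \<le> c"
    using c by (simp add: field_simps)
  finally have "lp_norm p ?w \<le> (e powr p) powr (1 / p)"
    unfolding lp_norm_def using p w
    by (intro powr_mono2) (auto simp: c_def lp_space_def intro: suminf_nonneg)
  then show ?thesis
    using p e by (auto simp: lp_dist_def powr_powr)
qed

section \<open>The covering radius\<close>

theorem proposition3:
  fixes p :: real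
  assumes "1 \<le> p"
  shows "\<exists>P. dispersed (lp_space p) (lp_dist p) (2 powr (1 / p)) P \<and>
             covering_radius (lp_space p) (lp_dist p) P = 1"
proof -
  interpret Metric_space "lp_space p" "lp_dist p"
    by (rule Metric_space_lp[OF assms])
  obtain P where disp: "dispersed (lp_space p) (lp_dist p) (2 powr (1 / p)) P"
    and norm: "\<And>q. q \<in> P \<Longrightarrow> lp_norm p q \<ge> 1"
    and near: "\<And>n. \<exists>q\<in>P. lp_dist p (padded (from_nat n)) q \<le> 1"
    using greedy_set[OF assms, of "\<lambda>n. padded (from_nat n)"] finite_support_padded by auto
  have P: "P \<subseteq> lp_space p"
    using disp by (simp add: dispersed_def)
  have covering: "is_covering (lp_space p) (lp_dist p) (1 + e) P" if e: "e > 0" for e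
  proof -
    have "\<exists>q\<in>P. z \<in> mcball q (1 + e)" if z: "z \<in> lp_space p" for z
    proof -
      obtain l where l: "lp_dist p (padded l) z \<le> e"
        using lp_rational_approx[OF assms z e] by blast
      obtain q where q: "q \<in> P" "lp_dist p (padded l) q \<le> 1"
        using near[of "to_nat l"] by auto
      have "padded l \<in> lp_space p"
        by (intro lp_space_finite_support finite_support_padded)
      then have "lp_dist p q z \<le> 1 + e"
        using triangle[of q "padded l" z] commute[of q "padded l"] l q z P by fastforce
      then show ?thesis
        using q z P by auto
    qed
    then show ?thesis
      using P by (auto simp: is_covering_def)
  qed
  have "covering_radius (lp_space p) (lp_dist p) P \<le> 1"
  proof (rule ereal_le_epsilon2)
    fix e :: real
    assume "e > 0"
    then have "covering_radius (lp_space p) (lp_dist p) P \<le> ereal (1 + e)"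
      unfolding covering_radius_def using covering by (intro Inf_lower) blast
    then show "covering_radius (lp_space p) (lp_dist p) P \<le> 1 + ereal e"
      by (simp add: one_ereal_def)
  qed
  moreover have "1 \<le> covering_radius (lp_space p) (lp_dist p) P"
    unfolding covering_radius_def
  proof (rule Inf_greatest)
    fix R'
    assume "R' \<in> {ereal R |R. is_covering (lp_space p) (lp_dist p) R P}"
    then obtain R where R: "R' = ereal R" "is_covering (lp_space p) (lp_dist p) R P"
      by auto
    \<comment> \<open>The origin has distance at least \<open>1\<close> from \<open>P\<close>, so \<open>R\<close> cannot be smaller.\<close>
    have "(\<lambda>_. 0) \<in> lp_space p"
      by (rule lp_space_finite_support) simp
    then obtain q where "q \<in> P" "lp_dist p q (\<lambda>_. 0) \<le> R"
      using R(2) unfolding is_covering_def by (metis UN_E in_mcball)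
    then show "1 \<le> R'"
      using norm[of q] R(1) by (simp add: lp_dist_def)
  qed
  ultimately show ?thesis
    using disp by (auto intro: antisym)
qed

end
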